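(* For every integer $m \geq 4$, the number $\ell(m)$ of indecomposable solutions of $(\mathrm{C}_m)$ satisfies $$\ell(m) \leq \sum_{s=1}^{\mathsf{SD}(m)} \binom{m-1}{s,\; s-1,\; m-2s},$$ a sum of trinomial coefficients. In particular $\ell(m) < 3^{m-1}$ for every integer $m \geq 2$.
   Context: $\mathbb{N} = \{0,1,2,\ldots\}$. For an integer $m \geq 2$, $(\mathrm{C}_m)$ denotes the congruence $1\cdot x_1 + 2\cdot x_2 + \cdots + (m-1)\cdot x_{m-1} \equiv 0 \pmod m$ for unknown $x = (x_1,\ldots,x_{m-1}) \in \mathbb{N}^{m-1}$. A solution is indecomposable if it is nonzero and minimal among the nonzero solutions in $\mathbb{N}^{m-1}$ with respect to the componentwise order; $\ell(m)$ is the number of indecomposable solutions of $(\mathrm{C}_m)$. The width of $x$ is $\sigma(x) = \#\{i : x_i \neq 0\}$, and $\mathsf{SD}(m) = \max\{\sigma(x) : x \text{ is an indecomposable solution of } (\mathrm{C}_m)\}$. The trinomial coefficient is $\binom{n}{p,q,r} = \frac{n!}{p!\,q!\,r!}$ for $p,q,r \in \mathbb{N}$ with $p+q+r=n$. (For $m \geq 4$ one has $2\,\mathsf{SD}(m) \leq m$, so all trinomial coefficients in the sum are defined.) *)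

theory Defs
  imports "HOL-Number_Theory.Cong"
begin

text \<open>
  A vector \<open>(x\<^sub>1, \<dots>, x\<^sub>m\<^sub>-\<^sub>1)\<close> of natural numbers is encoded as a function on all of \<open>nat\<close> that
  vanishes outside \<open>{1..m-1}\<close>. With this encoding the library's pointwise order on functions is
  the componentwise order on vectors.
\<close>

definition solutions :: "nat \<Rightarrow> (nat \<Rightarrow> nat) set" where
  "solutions m = {x. (\<forall>i. i \<notin> {1..m-1} \<longrightarrow> x i = 0) \<and> [(\<Sum>i=1..m-1. i * x i) = 0] (mod m)}"

definition indecomposables :: "nat \<Rightarrow> (nat \<Rightarrow> nat) set" where
  "indecomposables m = {x \<in> solutions m - {\<lambda>_. 0}. \<forall>y \<in> solutions m - {\<lambda>_. 0}. y \<le> x \<longrightarrow> y = x}"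

definition ell :: "nat \<Rightarrow> nat" where
  "ell m = card (indecomposables m)"

definition width :: "(nat \<Rightarrow> nat) \<Rightarrow> nat" where
  "width x = card {i. x i \<noteq> 0}"

definition SD :: "nat \<Rightarrow> nat" where
  "SD m = Max (width ` indecomposables m)"

text \<open>
  The division is exact when \<open>p + q + r = n\<close>, the only case in which the coefficient is meaningful.
  This is the case for \<open>trinomial (m-1) s (s-1) (m-2*s)\<close> when \<open>1 \<le> s\<close> and \<open>2*s \<le> m\<close>; for \<open>m \<ge> 4\<close> one has
  \<open>2 * SD m \<le> m\<close>, so the subtractions are not truncated for \<open>s \<le> SD m\<close>.
\<close>

definition trinomial :: "nat \<Rightarrow> nat \<Rightarrow> nat \<Rightarrow> nat \<Rightarrow> nat" where
  "trinomial n p q r = fact n div (fact p * fact q * fact r)"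

text \<open>
  For \<open>m \<ge> 2\<close> the set of indecomposable solutions is finite and nonempty, so that the \<open>card\<close> and
  the \<open>Max\<close> above never take a default value.
\<close>

definition axis_solution :: "nat \<Rightarrow> nat \<Rightarrow> nat \<Rightarrow> nat" where
  "axis_solution m i = (\<lambda>j. if j = i then m else 0)"

lemma axis_solution_in_solutions:
  assumes "m \<ge> 2" and "i \<in> {1..m-1}"
  shows "axis_solution m i \<in> solutions m - {\<lambda>_. 0}"
proof -
  have "(\<Sum>j=1..m-1. j * axis_solution m i j) = (\<Sum>j=1..m-1. if j = i then i * m else 0)"
    by (intro sum.cong) (auto simp: axis_solution_def)
  also have "\<dots> = i * m" using assms(2) by simp
  finally have "[(\<Sum>j=1..m-1. j * axis_solution m i j) = 0] (mod m)" by (simp add: cong_def)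
  moreover have "axis_solution m i \<noteq> (\<lambda>_. 0)"
    using assms by (auto simp: axis_solution_def fun_eq_iff)
  moreover have "\<forall>j. j \<notin> {1..m-1} \<longrightarrow> axis_solution m i j = 0"
    using assms(2) by (auto simp: axis_solution_def)
  ultimately show ?thesis by (simp add: solutions_def)
qed

lemma indecomposable_le:
  assumes "m \<ge> 2" and "x \<in> indecomposables m"
  shows "x i \<le> m"
proof (rule ccontr)
  assume "\<not> x i \<le> m"
  then have gt: "m < x i" by simp
  then have "i \<in> {1..m-1}"
    using assms(2) by (force simp: indecomposables_def solutions_def)
  then have "axis_solution m i \<in> solutions m - {\<lambda>_. 0}"
    using assms(1) axis_solution_in_solutions by blast
  moreover have "axis_solution m i \<le> x"
    using gt by (auto simp: le_fun_def axis_solution_def)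
  ultimately have "axis_solution m i = x"
    using assms(2) unfolding indecomposables_def by blast
  then have "x i = m" by (auto simp: axis_solution_def)
  with gt show False by simp
qed

lemma finite_indecomposables:
  assumes "m \<ge> 2"
  shows "finite (indecomposables m)"
proof (rule finite_subset)
  show "indecomposables m
      \<subseteq> {x. \<forall>i. (i \<in> {1..m-1} \<longrightarrow> x i \<in> {..m}) \<and> (i \<notin> {1..m-1} \<longrightarrow> x i = 0)}"
    using indecomposable_le[OF assms] by (auto simp: indecomposables_def solutions_def)
  show "finite {x::nat \<Rightarrow> nat. \<forall>i. (i \<in> {1..m-1} \<longrightarrow> x i \<in> {..m}) \<and> (i \<notin> {1..m-1} \<longrightarrow> x i = 0)}"
    by (rule finite_set_of_finite_funs) auto
qed

lemma indecomposables_nonempty: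
  assumes "m \<ge> 2"
  shows "indecomposables m \<noteq> {}"
proof -
  have "y = axis_solution m 1"
    if y: "y \<in> solutions m" "y \<noteq> (\<lambda>_. 0)" and le: "y \<le> axis_solution m 1" for y
  proof -
    have le': "y j \<le> axis_solution m 1 j" for j
      using le by (simp add: le_fun_def)
    have off: "y j = 0" if "j \<noteq> 1" for j
      using le'[of j] that by (simp add: axis_solution_def)
    have "(\<Sum>j=1..m-1. j * y j) = (\<Sum>j=1..m-1. if j = 1 then y 1 else 0)"
      by (intro sum.cong) (auto simp: off)
    also have "\<dots> = y 1" using assms by simp
    finally have "m dvd y 1" using y(1) by (simp add: solutions_def cong_0_iff)
    moreover have "y 1 \<noteq> 0"
    proof
      assume "y 1 = 0"
      then have "y j = 0" for j using off[of j] by (cases "j = 1") auto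
      with y(2) show False by auto
    qed
    moreover have "y 1 \<le> m" using le'[of 1] by (simp add: axis_solution_def)
    ultimately have "y 1 = m" by (meson dvd_imp_le le_antisym not_gr_zero)
    then show ?thesis using off by (auto simp: axis_solution_def fun_eq_iff)
  qed
  then have "axis_solution m 1 \<in> indecomposables m"
    using axis_solution_in_solutions[OF assms, of 1] assms
    by (auto simp: indecomposables_def)
  then show ?thesis by blast
qed

end

theory Submission
  imports Defs
begin

text \<open>
  Indecomposable solutions form an antichain, so two of them that agree off a single coordinate
  coincide. It therefore suffices to find, for each support \<open>S\<close> of size \<open>s\<close>, a coordinate \<open>i\<close> in \<open>S\<close> such that
  the remaining coordinates of every indecomposable solution with support \<open>S\<close> have sum at most \<open>m - 1 - s\<close>:
  there are \<open>(m - 1 - s) choose (s - 1)\<close> vectors of \<open>s - 1\<close> positive numbers with that property.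

  Read \<open>x\<close> as a sequence over the integers modulo \<open>m\<close> in which \<open>i\<close> occurs \<open>x i\<close> times. Indecomposability says
  that no proper nonempty subsequence has sum zero. For such a zero-sum free sequence each additional
  term produces at least one new subsequence sum, and there are at most \<open>m\<close> of them. Starting from
  the sums over subsets of the support \<open>V\<close>, of which there are at least \<open>2 |V| + 2 - e\<close> if \<open>|V| \<ge> 3\<close>, where \<open>e\<close> is
  the number of \<open>v\<close> in \<open>V\<close> with \<open>2 v = \<Sum>V\<close>, one bounds the length. If \<open>e \<le> 1\<close> for \<open>S\<close>, every coordinate works.
  If \<open>e \<ge> 2\<close>, doubling is not injective on \<open>S\<close>; for \<open>s \<ge> 4\<close> this yields an \<open>i\<close> with \<open>e = 0\<close> for \<open>S - {i}\<close>, while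
  for \<open>s = 3\<close> (and likewise for \<open>s = 2\<close>) two bad coordinates satisfy incompatible congruences.
\<close>

section \<open>Subsequence sums of zero-sum free sequences\<close>

definition wsum :: "nat \<Rightarrow> (nat \<Rightarrow> nat) \<Rightarrow> nat" where
  "wsum m y = (\<Sum>i=1..m-1. i * y i)"

definition subsums :: "nat \<Rightarrow> (nat \<Rightarrow> nat) \<Rightarrow> nat set" where
  "subsums m z = (\<lambda>y. wsum m y mod m) ` {..z}"

text \<open>The classical notion of a zero-sum free sequence over the integers modulo
  \<open>m\<close>, with \<open>z i\<close> the multiplicity of \<open>i\<close>. Unlike for an
  indecomposable solution, the whole sequence must not sum to zero either, unless it is
  empty.\<close>

definition zero_free :: "nat \<Rightarrow> (nat \<Rightarrow> nat) \<Rightarrow> bool" where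
  "zero_free m z \<longleftrightarrow> (\<forall>i. i \<notin> {1..m-1} \<longrightarrow> z i = 0) \<and> (\<forall>y\<in>solutions m. y \<le> z \<longrightarrow> y = (\<lambda>_. 0))"

lemma solutions_iff: "x \<in> solutions m \<longleftrightarrow> (\<forall>i. i \<notin> {1..m-1} \<longrightarrow> x i = 0) \<and> m dvd wsum m x"
  by (simp add: solutions_def wsum_def cong_0_iff)

lemma wsum_Suc:
  assumes "j \<in> {1..m-1}"
  shows "wsum m (y(j := Suc (y j))) = wsum m y + j"
proof -
  have "wsum m (y(j := Suc (y j))) = (\<Sum>i=1..m-1. i * y i + (if i = j then j else 0))"
    unfolding wsum_def by (intro sum.cong) auto
  also have "\<dots> = wsum m y + j" using assms by (simp add: sum.distrib wsum_def)
  finally show ?thesis .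
qed

lemma wsum_of_bool:
  assumes "A \<subseteq> {1..m-1}"
  shows "wsum m (\<lambda>i. of_bool (i \<in> A)) = \<Sum>A"
proof -
  have "wsum m (\<lambda>i. of_bool (i \<in> A)) = (\<Sum>i\<in>{1..m-1}. if i \<in> A then i else 0)"
    unfolding wsum_def by (intro sum.cong) auto
  also have "\<dots> = \<Sum>({1..m-1} \<inter> A)" by (simp add: sum.If_cases)
  finally show ?thesis using assms by (simp add: Int_absorb1)
qed

lemma wsum_supp:
  assumes "{i. y i \<noteq> 0} \<subseteq> S" "S \<subseteq> {1..m-1}"
  shows "wsum m y = (\<Sum>i\<in>S. i * y i)"
  unfolding wsum_def using assms by (intro sum.mono_neutral_right) auto

lemma zero_free_mono: "zero_free m z \<Longrightarrow> w \<le> z \<Longrightarrow> zero_free m w"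
  unfolding zero_free_def by (metis le_fun_def le_zero_eq order_trans)

lemma zero_free_supp: "zero_free m z \<Longrightarrow> {i. z i \<noteq> 0} \<subseteq> {1..m-1}"
proof
  fix i assume zf: "zero_free m z" and "i \<in> {i. z i \<noteq> 0}"
  then have "z i \<noteq> 0" by simp
  then show "i \<in> {1..m-1}"
    by (rule contrapos_np) (use zf in \<open>simp add: zero_free_def del: atLeastAtMost_iff\<close>)
qed

lemma zero_freeD:
  assumes "zero_free m z" "y \<le> z" "m dvd wsum m y"
  shows "y = (\<lambda>_. 0)"
proof -
  have "y i = 0" if "i \<notin> {1..m-1}" for i
  proof -
    have "z i = 0" using assms(1) that unfolding zero_free_def by simp
    then show ?thesis using le_funD[OF assms(2), of i] by simp
  qed
  then have "y \<in> solutions m" using assms(3) by (simp add: solutions_iff)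
  then show ?thesis using assms(1,2) by (simp add: zero_free_def)
qed

lemma subsums_subset: "m \<ge> 1 \<Longrightarrow> subsums m z \<subseteq> {..<m}"
  by (auto simp: subsums_def)

lemma finite_subsums: "m \<ge> 1 \<Longrightarrow> finite (subsums m z)"
  using subsums_subset finite_subset by blast

lemma card_subsums_le: "m \<ge> 1 \<Longrightarrow> card (subsums m z) \<le> m"
  using card_mono[OF _ subsums_subset, of m z] by simp

lemma card_subsums_Suc:
  assumes m: "m \<ge> 1" and zf: "zero_free m (z(j := Suc (z j)))"
  shows "card (subsums m z) < card (subsums m (z(j := Suc (z j))))"
proof (rule psubset_card_mono)
  let ?z = "z(j := Suc (z j))"
  show "finite (subsums m ?z)" using m finite_subsums by blast
  have j: "j \<in> {1..m-1}" using zf unfolding zero_free_def by (metis fun_upd_same nat.distinct(1))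
  have step: "(wsum m y + j) mod m \<in> subsums m ?z" if "y \<le> z" for y
  proof -
    have "y(j := Suc (y j)) \<le> ?z" using that by (auto simp: le_fun_def)
    then show ?thesis unfolding subsums_def
      by (metis wsum_Suc[OF j] atMost_iff image_eqI)
  qed
  have sub: "subsums m z \<subseteq> subsums m ?z"
    unfolding subsums_def by (intro image_mono) (auto simp: le_fun_def intro: le_SucI)
  have "subsums m z \<noteq> subsums m ?z"
  proof
    \<comment> \<open>Otherwise the set of sums is invariant under adding \<open>j\<close>, hence contains \<open>- j\<close>.\<close>
    assume eq: "subsums m z = subsums m ?z"
    have "(k * j) mod m \<in> subsums m z" for k
    proof (induction k)
      case 0
      have "wsum m (\<lambda>_. 0) = 0" by (simp add: wsum_def)
      then show ?case unfolding subsums_def by (intro image_eqI[of _ _ "\<lambda>_. 0"]) (auto simp: le_fun_def)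
    next
      case (Suc k)
      then obtain y where y: "y \<le> z" "(k * j) mod m = wsum m y mod m" by (auto simp: subsums_def)
      have "(Suc k * j) mod m = (wsum m y + j) mod m"
        using y(2) by (metis add.commute mod_add_left_eq mult_Suc)
      then show ?case using step[OF y(1)] eq by simp
    qed
    \<comment> \<open>The multiple \<open>(m - 1) * j\<close> represents \<open>- j\<close>, so one
      more copy of \<open>j\<close> turns \<open>y\<close> into a nonzero vector with sum zero below
      \<open>?z\<close>.\<close>
    then obtain y where y: "y \<le> z" "((m - 1) * j) mod m = wsum m y mod m" by (force simp: subsums_def)
    have "(wsum m y + j) mod m = ((m - 1) * j + j) mod m"
      using y(2) by (metis mod_add_left_eq)
    also have "(m - 1) * j + j = m * j" using m by (simp add: algebra_simps)
    finally have "m dvd wsum m (y(j := Suc (y j)))" by (simp add: wsum_Suc[OF j] mod_eq_0_iff_dvd)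
    moreover have "y(j := Suc (y j)) \<le> ?z" using y(1) by (auto simp: le_fun_def)
    ultimately have "y(j := Suc (y j)) = (\<lambda>_. 0)" using zf zero_freeD by blast
    then show False by (metis fun_upd_same nat.distinct(1))
  qed
  with sub show "subsums m z \<subset> subsums m ?z" by blast
qed

lemma sum_fun_upd_pred:
  fixes z :: "nat \<Rightarrow> nat"
  assumes "finite A" "j \<in> A" "z j > 0"
  shows "sum z A = Suc (sum (z(j := z j - 1)) A)"
proof -
  have "sum z A = z j + sum z (A - {j})" using assms by (simp add: sum.remove)
  moreover have "sum (z(j := z j - 1)) A = (z j - 1) + sum z (A - {j})"
    using assms by (simp add: sum.remove)
  ultimately show ?thesis using assms by simp
qed

text \<open>Iterates \<open>card_subsums_Suc\<close> on the way from \<open>w\<close> up to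
  \<open>z\<close>: each added unit brings at least one new sum. The inequality between the two
  differences is written additively to avoid truncated subtraction.\<close>

lemma card_subsums_mono:
  assumes m: "m \<ge> 1" and "zero_free m z" and "w \<le> z"
  shows "card (subsums m w) + sum z {1..m-1} \<le> card (subsums m z) + sum w {1..m-1}"
  using assms(2,3)
proof (induction "sum z {1..m-1}" arbitrary: z rule: less_induct)
  case less
  show ?case
  proof (cases "w = z")
    case False
    then obtain j where j: "w j < z j" using less.prems(2)
      by (metis le_fun_def nat_less_le ext)
    let ?z = "z(j := z j - 1)"
    have jm: "j \<in> {1..m-1}" using less.prems(1) j unfolding zero_free_def by (metis not_less_zero)
    have z: "z = ?z(j := Suc (?z j))" using j by auto
    have le: "w \<le> ?z" using less.prems(2) j by (auto simp: le_fun_def)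
    have zf: "zero_free m ?z" by (rule zero_free_mono[OF less.prems(1)]) (auto simp: le_fun_def)
    have s: "sum z {1..m-1} = Suc (sum ?z {1..m-1})"
      using j jm by (intro sum_fun_upd_pred) auto
    have "card (subsums m w) + sum ?z {1..m-1} \<le> card (subsums m ?z) + sum w {1..m-1}"
      using less.hyps[OF _ zf le] s by simp
    moreover have "card (subsums m ?z) < card (subsums m z)"
      using card_subsums_Suc[OF m, of ?z j] z less.prems(1) by simp
    ultimately show ?thesis using s by simp
  qed simp
qed

lemma zero_free_subset_sum:
  assumes "zero_free m z" "A \<subseteq> {i. z i \<noteq> 0}" "A \<noteq> {}"
  shows "\<not> m dvd \<Sum>A"
proof
  assume d: "m dvd \<Sum>A"
  have "A \<subseteq> {1..m-1}" using assms(2) zero_free_supp[OF assms(1)] by (rule order_trans)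
  then have "m dvd wsum m (\<lambda>i. of_bool (i \<in> A))" using d by (simp add: wsum_of_bool)
  moreover have "(\<lambda>i. of_bool (i \<in> A)) \<le> z"
    using assms(2) by (auto simp: le_fun_def)
  ultimately have zero: "(\<lambda>i. of_bool (i \<in> A) :: nat) = (\<lambda>_. 0)"
    using zero_freeD[OF assms(1)] by blast
  obtain a where "a \<in> A" using assms(3) by blast
  then show False using fun_cong[OF zero, of a] by simp
qed

text \<open>Growth starts at the 0/1 vector of the support, whose subsequence sums already include
  \<open>P\<close>. Each further unit of \<open>z\<close> adds a sum, and only \<open>m\<close>
  residues are available.\<close>

lemma zero_free_card_bound:
  assumes m: "m \<ge> 1" and zf: "zero_free m z"
    and P: "P \<subseteq> (\<lambda>A. \<Sum>A mod m) ` Pow {i. z i \<noteq> 0}"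
  shows "card P + sum z {1..m-1} \<le> m + card {i. z i \<noteq> 0}"
proof -
  let ?V = "{i. z i \<noteq> 0}"
  let ?w = "\<lambda>i. of_bool (i \<in> ?V) :: nat"
  have V: "?V \<subseteq> {1..m-1}" using zf by (rule zero_free_supp)
  have "P \<subseteq> subsums m ?w"
  proof
    fix p assume "p \<in> P"
    then obtain A where A: "A \<subseteq> ?V" "p = \<Sum>A mod m" using P by blast
    have "(\<lambda>i. of_bool (i \<in> A)) \<le> ?w" using A(1) by (auto simp: le_fun_def)
    moreover have "p = wsum m (\<lambda>i. of_bool (i \<in> A)) mod m"
      using A V wsum_of_bool[of A m] by (metis order_trans)
    ultimately show "p \<in> subsums m ?w" unfolding subsums_def by blast
  qed
  then have "card P \<le> card (subsums m ?w)" using m by (intro card_mono finite_subsums)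
  moreover have "?w \<le> z" by (auto simp: le_fun_def)
  then have "card (subsums m ?w) + sum z {1..m-1} \<le> card (subsums m z) + sum ?w {1..m-1}"
    using card_subsums_mono[OF m zf] by blast
  moreover have "sum ?w {1..m-1} = card ?V"
    using V by (simp add: sum.If_cases of_bool_def Int_absorb1 del: mem_Collect_eq)
  ultimately show ?thesis using card_subsums_le[OF m, of z] by linarith
qed

lemma sum_diff_mod_zero:
  fixes A B :: "nat set"
  assumes "finite A" "B \<subseteq> A" "\<Sum>A mod m = \<Sum>B mod m"
  shows "m dvd \<Sum>(A - B)"
proof -
  have "\<Sum>A = \<Sum>(A - B) + \<Sum>B" using assms(1,2) by (metis sum.subset_diff)
  then have "[\<Sum>(A - B) + \<Sum>B = 0 + \<Sum>B] (mod m)" using assms(3) by (simp add: cong_def)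
  then show ?thesis by (simp only: cong_add_rcancel_nat cong_0_iff)
qed

text \<open>The sums 0, \<open>\<Sum>V\<close> and the elements of the support \<open>V\<close> are
  \<open>card V + 2\<close> distinct residues, since any coincidence would leave a nonempty subset
  of \<open>V\<close> with sum zero. This serves the supports of size two.\<close>

lemma zero_free_length_ge2:
  assumes m: "m \<ge> 1" and zf: "zero_free m z" and card: "card {i. z i \<noteq> 0} \<ge> 2"
  shows "sum z {1..m-1} + 2 \<le> m"
proof -
  let ?V = "{i. z i \<noteq> 0}"
  have V: "?V \<subseteq> {1..m-1}" using zf by (rule zero_free_supp)
  have fin: "finite ?V" using card by (metis card.infinite not_numeral_le_zero)
  let ?P = "{0, \<Sum>?V mod m} \<union> ?V"
  have "?V \<noteq> {}" using card by (metis card.empty not_numeral_le_zero)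
  then have nz: "\<Sum>?V mod m \<noteq> 0"
    using zero_free_subset_sum[OF zf order_refl] by (simp add: mod_eq_0_iff_dvd)
  have nV: "\<Sum>?V mod m \<notin> ?V"
  proof
    assume v: "\<Sum>?V mod m \<in> ?V"
    let ?v = "\<Sum>?V mod m"
    have "?V - {?v} \<noteq> {}" using card fin v
      by (metis card.empty card_Diff_singleton Suc_1 diff_is_0_eq not_less_eq_eq One_nat_def)
    moreover have "m dvd \<Sum>(?V - {?v})" by (rule sum_diff_mod_zero[OF fin]) (use v in auto)
    ultimately show False using zero_free_subset_sum[OF zf, of "?V - {?v}"] by blast
  qed
  have "0 \<notin> ?V" using V by force
  then have "card ?P = 2 + card ?V" using nz nV fin
    by (simp add: card_insert_if del: mem_Collect_eq)
  moreover have "?P \<subseteq> (\<lambda>A. \<Sum>A mod m) ` Pow ?V"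
  proof -
    have "0 \<in> (\<lambda>A. \<Sum>A mod m) ` Pow ?V" by (rule image_eqI[of _ _ "{}"]) auto
    moreover have "v \<in> (\<lambda>A. \<Sum>A mod m) ` Pow ?V" if "v \<in> ?V" for v
      using that V by (intro image_eqI[of _ _ "{v}"]) force+
    ultimately show ?thesis by blast
  qed
  ultimately show ?thesis using zero_free_card_bound[OF m zf, of ?P] by linarith
qed

text \<open>Putting the removed elements back gives \<open>i\<close> congruent to \<open>j\<close>,
  and both lie below \<open>m\<close>.\<close>

lemma sum_remove_cong_imp_eq:
  assumes "finite S" "S \<subseteq> {1..m-1}" "i \<in> S" "j \<in> S" "[\<Sum>(S - {i}) = \<Sum>(S - {j})] (mod m)"
  shows "i = (j::nat)"
proof -
  have split: "\<Sum>S = \<Sum>(S - {v}) + v" if "v \<in> S" for v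
    using sum.remove[OF assms(1) that, of "\<lambda>x. x"] by simp
  have "[\<Sum>(S - {i}) + i = \<Sum>(S - {j}) + j] (mod m)"
    using split[OF assms(3)] split[OF assms(4)] by simp
  then have "[i = j] (mod m)"
    using assms(5) by (meson cong_add_lcancel_nat cong_add_rcancel_nat cong_sym cong_trans)
  moreover have "i < m" "j < m" using assms(2-4) by fastforce+
  ultimately show ?thesis by (simp add: cong_less_modulus_unique_nat)
qed

text \<open>
  The sums counted here are \<open>0\<close>, \<open>\<Sum>V\<close>, the elements \<open>v\<close> of \<open>V\<close> and the sums \<open>\<Sum>V - v\<close>. Modulo \<open>m\<close>, the only
  possible coincidence is \<open>v = \<Sum>V - v\<close>: any other one exhibits a nonempty subset of \<open>V\<close> with sum zero.
\<close>

lemma zero_free_length_ge3: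
  assumes m: "m \<ge> 1" and zf: "zero_free m z"
    and V_def: "V = {i. z i \<noteq> 0}" and card: "card V \<ge> 3"
  shows "sum z {1..m-1} + card V + 2 \<le> m + card {v\<in>V. [2 * v = \<Sum>V] (mod m)}"
proof -
  have V: "V \<subseteq> {1..m-1}" using zf unfolding V_def by (rule zero_free_supp)
  have fin: "finite V" using card unfolding V_def by (metis card.infinite not_numeral_le_zero)
  have free: "\<not> m dvd \<Sum>A" if "A \<subseteq> V" "A \<noteq> {}" for A
    using zero_free_subset_sum[OF zf] that unfolding V_def by blast
  \<comment> \<open>This is where \<open>card V \<ge> 3\<close> enters: after deleting two elements
    something is left, and it cannot sum to zero.\<close>
  have remove: "\<not> m dvd \<Sum>(V - A)" if "finite A" "card A \<le> 2" for A
  proof (rule free)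
    show "V - A \<noteq> {}" using card_mono[of A V] that card unfolding V_def by fastforce
  qed auto
  define f where "f v = \<Sum>(V - {v}) mod m" for v
  have small: "v mod m = v" if "v \<in> V" for v using V that by force
  have split: "\<Sum>V = \<Sum>(V - {v}) + v" if "v \<in> V" for v
    using sum.remove[OF fin that, of "\<lambda>x. x"] by simp
  have inj: "inj_on f V"
  proof (rule inj_onI)
    fix v w assume vw: "v \<in> V" "w \<in> V" "f v = f w"
    have "[\<Sum>(V - {v}) = \<Sum>(V - {w})] (mod m)" using vw(3) by (simp add: f_def cong_def)
    then show "v = w" by (rule sum_remove_cong_imp_eq[OF fin V vw(1,2)])
  qed
  have inter: "V \<inter> f ` V \<subseteq> {v\<in>V. [2 * v = \<Sum>V] (mod m)}"
  proof
    fix v assume "v \<in> V \<inter> f ` V"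
    then obtain w where vw: "v \<in> V" "w \<in> V" "v = f w" by auto
    have "w = v"
    proof (rule ccontr)
      assume ne: "w \<noteq> v"
      have "\<Sum>(V - {w}) mod m = \<Sum>{v} mod m" using vw small by (simp add: f_def)
      then have "m dvd \<Sum>(V - {w} - {v})" using fin vw ne by (intro sum_diff_mod_zero) auto
      moreover have "V - {w} - {v} = V - {w, v}" by blast
      ultimately show False using remove[of "{w, v}"] by (simp add: card_insert_if)
    qed
    then have "[v = \<Sum>(V - {v})] (mod m)" using vw small by (simp add: cong_def f_def)
    then have "[v + v = \<Sum>V] (mod m)" using split[OF vw(1)] by (simp add: cong_add_rcancel_nat)
    then show "v \<in> {v\<in>V. [2 * v = \<Sum>V] (mod m)}" using vw by (simp add: mult_2)
  qed
  have "0 \<notin> V" using V by force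
  moreover have "f v \<noteq> 0" for v using remove[of "{v}"] by (simp add: f_def mod_eq_0_iff_dvd)
  then have "0 \<notin> f ` V" by (metis imageE)
  moreover have "\<Sum>V mod m \<noteq> 0" using remove[of "{}"] by (simp add: mod_eq_0_iff_dvd)
  moreover have "\<Sum>V mod m \<notin> V"
  proof
    assume v: "\<Sum>V mod m \<in> V"
    have "m dvd \<Sum>(V - {\<Sum>V mod m})" by (rule sum_diff_mod_zero[OF fin]) (use v in auto)
    then show False using remove[of "{\<Sum>V mod m}"] by simp
  qed
  moreover have "\<Sum>V mod m \<notin> f ` V"
  proof
    assume "\<Sum>V mod m \<in> f ` V"
    then obtain v where v: "v \<in> V" "\<Sum>V mod m = \<Sum>(V - {v}) mod m" by (auto simp: f_def)
    have "m dvd \<Sum>(V - (V - {v}))" by (rule sum_diff_mod_zero[OF fin]) (use v in auto)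
    then have "m dvd v" using v by (simp add: double_diff)
    then show False using free[of "{v}"] v by simp
  qed
  ultimately have "card ({0, \<Sum>V mod m} \<union> (V \<union> f ` V)) = 2 + card (V \<union> f ` V)"
    using fin by (simp add: card_insert_if)
  moreover have "card (V \<union> f ` V) + card (V \<inter> f ` V) = 2 * card V"
    using card_Un_Int[OF fin, of "f ` V"] fin card_image[OF inj] by simp
  moreover have "card (V \<inter> f ` V) \<le> card {v\<in>V. [2 * v = \<Sum>V] (mod m)}"
    using inter fin by (intro card_mono) auto
  moreover have "{0, \<Sum>V mod m} \<union> (V \<union> f ` V) \<subseteq> (\<lambda>A. \<Sum>A mod m) ` Pow V"
  proof -
    have "0 \<in> (\<lambda>A. \<Sum>A mod m) ` Pow V" by (rule image_eqI[of _ _ "{}"]) auto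
    moreover have "v \<in> (\<lambda>A. \<Sum>A mod m) ` Pow V" if "v \<in> V" for v
      using that small by (intro image_eqI[of _ _ "{v}"]) auto
    moreover have "f v \<in> (\<lambda>A. \<Sum>A mod m) ` Pow V" for v unfolding f_def by blast
    ultimately show ?thesis by blast
  qed
  then have "card ({0, \<Sum>V mod m} \<union> (V \<union> f ` V)) + sum z {1..m-1} \<le> m + card V"
    using zero_free_card_bound[OF m zf] unfolding V_def by blast
  ultimately show ?thesis by linarith
qed

section \<open>Indecomposable solutions, their supports and lengths\<close>

lemma indecomposable_eq:
  assumes "x \<in> indecomposables m" "y \<in> solutions m" "y \<le> x" "y i \<noteq> 0"
  shows "y = x"
proof -
  have "y \<in> solutions m - {\<lambda>_. 0}" using assms(2,4) by auto
  then show ?thesis using assms(1,3) unfolding indecomposables_def by blast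
qed

lemma indecomposable_solution: "x \<in> indecomposables m \<Longrightarrow> x \<in> solutions m"
  by (simp add: indecomposables_def)

lemma indecomposable_supp:
  assumes "x \<in> indecomposables m"
  shows "{i. x i \<noteq> 0} \<subseteq> {1..m-1}"
proof
  fix i assume "i \<in> {i. x i \<noteq> 0}"
  then have "x i \<noteq> 0" by simp
  then show "i \<in> {1..m-1}"
    by (rule contrapos_np)
      (use indecomposable_solution[OF assms] in \<open>simp add: solutions_def del: atLeastAtMost_iff\<close>)
qed

lemma indecomposable_supp_nonempty: "x \<in> indecomposables m \<Longrightarrow> {i. x i \<noteq> 0} \<noteq> {}"
  by (auto simp: indecomposables_def)

lemma indecomposable_zero_free:
  assumes "x \<in> indecomposables m" "z \<le> x" "z \<noteq> x"
  shows "zero_free m z"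
  unfolding zero_free_def
proof (intro conjI allI impI ballI)
  fix i assume "i \<notin> {1..m-1}"
  then have "x i = 0" using indecomposable_solution[OF assms(1)] by (simp add: solutions_def del: atLeastAtMost_iff)
  then show "z i = 0" using le_funD[OF assms(2), of i] by simp
next
  fix y assume y: "y \<in> solutions m" "y \<le> z"
  show "y = (\<lambda>_. 0)"
  proof (rule ext, rule ccontr)
    fix i assume "y i \<noteq> 0"
    then have "y = x" using indecomposable_eq[OF assms(1) y(1)] y(2) assms(2) by (meson order_trans)
    then show False using y(2) assms(2,3) by simp
  qed
qed

lemma sum_supp:
  fixes x :: "nat \<Rightarrow> nat"
  assumes "{i. x i \<noteq> 0} \<subseteq> S" "S \<subseteq> {1..m-1}"
  shows "sum x {1..m-1} = sum x S"
  using assms by (intro sum.mono_neutral_right) auto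

text \<open>The \<open>k\<close> copies of \<open>i\<close> already form a solution below
  \<open>x\<close>, so by minimality they are all of \<open>x\<close>. For larger supports this
  limits the multiplicity of elements of small order.\<close>

lemma indecomposable_axis:
  assumes "x \<in> indecomposables m" "k > 0" "k \<le> x i" "m dvd k * i"
  shows "{i. x i \<noteq> 0} = {i}"
proof -
  let ?y = "\<lambda>j. if j = i then k else 0"
  have i: "i \<in> {1..m-1}" using subsetD[OF indecomposable_supp[OF assms(1)], of i] assms(2,3) by simp
  have "wsum m ?y = (\<Sum>j\<in>{i}. j * ?y j)" using i by (intro wsum_supp) auto
  then have "m dvd wsum m ?y" using assms(4) by (simp add: mult.commute)
  then have "?y \<in> solutions m" using i by (auto simp: solutions_iff)
  moreover have "?y \<le> x" using assms(3) by (auto simp: le_fun_def)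
  ultimately have y: "?y = x" using assms(2) by (intro indecomposable_eq[OF assms(1), of ?y i]) auto
  have "x j \<noteq> 0 \<longleftrightarrow> j = i" for j using fun_cong[OF y, of j] assms(2) by (auto split: if_splits)
  then show ?thesis by blast
qed

text \<open>If the support \<open>S\<close> contains distinct \<open>i\<close> and
  \<open>m - i\<close>, these two alone form a solution and exhaust \<open>x\<close>. So for
  \<open>card S > 2\<close> the set \<open>S\<close> and its reflection meet at most in
  \<open>m div 2\<close>, and both lie in a set of size \<open>m - 1\<close>.\<close>

lemma two_card_supp_le:
  assumes m: "m \<ge> 4" and x: "x \<in> indecomposables m"
  shows "2 * card {i. x i \<noteq> 0} \<le> m"
proof (cases "card {i. x i \<noteq> 0} \<le> 2")
  case True
  then show ?thesis using m by simp
next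
  case False
  define S where "S = {i. x i \<noteq> 0}"
  have S: "S \<subseteq> {1..m-1}" using indecomposable_supp[OF x] by (simp add: S_def)
  have fin: "finite S" using S finite_subset by blast
  let ?R = "(\<lambda>i. m - i) ` S"
  have inj: "inj_on (\<lambda>i. m - i) S" using S by (intro inj_onI) (auto simp: subset_iff)
  have "2 * i = m" if i: "i \<in> S \<inter> ?R" for i
  proof (rule ccontr)
    assume ne: "2 * i \<noteq> m"
    obtain j where j: "j \<in> S" "i = m - j" using i by auto
    have ij: "i + j = m" "i \<noteq> j" "{i, j} \<subseteq> {1..m-1}"
      using j subsetD[OF S, of j] subsetD[OF S, of i] ne i by auto
    let ?y = "\<lambda>k. of_bool (k \<in> {i, j}) :: nat"
    have "wsum m ?y = m" using wsum_of_bool[OF ij(3)] ij(1,2) by simp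
    then have "?y \<in> solutions m" using ij(3) by (auto simp: solutions_iff)
    moreover have "?y \<le> x" using i j(1) by (auto simp: le_fun_def S_def)
    ultimately have y: "?y = x" by (intro indecomposable_eq[OF x, of ?y i]) auto
    have "x k \<noteq> 0 \<longleftrightarrow> k \<in> {i, j}" for k
      unfolding fun_cong[OF y, of k, symmetric] by (rule of_bool_eq_0_iff[THEN arg_cong[where f=Not], unfolded not_not])
    then have "S = {i, j}" unfolding S_def by blast
    then show False using False by (simp add: S_def card_insert_if split: if_splits)
  qed
  then have "S \<inter> ?R \<subseteq> {m div 2}" by fastforce
  then have "card (S \<inter> ?R) \<le> 1" using card_mono[of "{m div 2}" "S \<inter> ?R"] by simp
  moreover have "?R \<subseteq> {1..m-1}" using S by fastforce
  then have "card (S \<union> ?R) \<le> card {1..m-1}" using S by (intro card_mono) simp_all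
  moreover have "card S + card ?R = card (S \<union> ?R) + card (S \<inter> ?R)"
    using fin by (intro card_Un_Int) auto
  ultimately show ?thesis using card_image[OF inj] m by (simp add: S_def)
qed

text \<open>Taking one unit from a coordinate of multiplicity at least two makes the sequence
  zero-sum free without changing its support, so the bounds above apply to \<open>S\<close> itself
  at the cost of one unit of length.\<close>

lemma indecomposable_pred:
  assumes x: "x \<in> indecomposables m" and j: "x j \<ge> 2"
  defines "z \<equiv> x(j := x j - 1)" and "S \<equiv> {i. x i \<noteq> 0}"
  shows "zero_free m z" "{i. z i \<noteq> 0} = S" "sum x S = Suc (sum z {1..m-1})"
proof -
  show "zero_free m z"
  proof (rule indecomposable_zero_free[OF x])
    show "z \<le> x" by (simp add: z_def le_fun_def)
    have "z j \<noteq> x j" using j by (simp add: z_def)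
    then show "z \<noteq> x" by auto
  qed
  show "{i. z i \<noteq> 0} = S" using j by (auto simp: z_def S_def)
  have S: "S \<subseteq> {1..m-1}" using indecomposable_supp[OF x] by (simp add: S_def)
  have "sum x S = sum x {1..m-1}" using S by (intro sum_supp[symmetric]) (auto simp: S_def)
  also have "\<dots> = Suc (sum z {1..m-1})"
    unfolding z_def using j subsetD[OF S, of j] by (intro sum_fun_upd_pred) (simp_all add: S_def)
  finally show "sum x S = Suc (sum z {1..m-1})" .
qed

lemma sum_all_one:
  fixes x :: "nat \<Rightarrow> nat"
  assumes "\<not> (\<exists>j. x j \<ge> 2)"
  shows "sum x {i. x i \<noteq> 0} = card {i. x i \<noteq> 0}"
proof -
  have "x i = 1" if "x i \<noteq> 0" for i
  proof -
    have "\<not> x i \<ge> 2" using assms by blast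
    then show ?thesis using that by simp
  qed
  then have "sum x {i. x i \<noteq> 0} = (\<Sum>i\<in>{i. x i \<noteq> 0}. 1)" by (intro sum.cong) auto
  then show ?thesis by simp
qed

text \<open>If some multiplicity exceeds one, the bound comes from
  \<open>zero_free_length_ge3\<close> after removing a unit. Otherwise the length is
  \<open>card S\<close>, and \<open>2 * card S \<le> m\<close> accounts for the 1 in the
  maximum.\<close>

lemma indecomposable_length_ge3:
  assumes m: "m \<ge> 4" and x: "x \<in> indecomposables m" and card: "card S \<ge> 3"
    and S: "S = {i. x i \<noteq> 0}"
  shows "sum x S + card S + 1 \<le> m + max 1 (card {v\<in>S. [2 * v = \<Sum>S] (mod m)})"
proof (cases "\<exists>j. x j \<ge> 2")
  case True
  then obtain j where j: "x j \<ge> 2" by blast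
  note z = indecomposable_pred[OF x j, folded S]
  show ?thesis using zero_free_length_ge3[OF _ z(1) z(2)[symmetric] card] m z(3) by simp
next
  case False
  then show ?thesis using sum_all_one[OF False] two_card_supp_le[OF m x] S by simp
qed

section \<open>A coordinate whose removal leaves a small sum\<close>

lemma sum_remove_lt:
  fixes x :: "nat \<Rightarrow> nat"
  assumes "finite S" "i \<in> S" "x i \<noteq> 0"
  shows "sum x (S - {i}) < sum x S"
  using assms by (simp add: sum.remove)

text \<open>The coordinate that can be forgotten when counting: the bound
  \<open>m - 1 - card S\<close> on the other entries is the one that yields the wanted binomial. It
  is stated additively so that no subtraction is truncated.\<close>

definition light :: "nat \<Rightarrow> nat set \<Rightarrow> nat \<Rightarrow> bool" where
  "light m S i \<longleftrightarrow>
  (\<forall>x\<in>indecomposables m. {i. x i \<noteq> 0} = S \<longrightarrow> sum x (S - {i}) + card S + 1 \<le> m)"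

text \<open>Here the total length is at most \<open>m - card S\<close>, and dropping a positive
  entry saves the one remaining unit.\<close>

lemma light_coordinate_few_halves:
  assumes m: "m \<ge> 4" and card: "card S \<ge> 3"
    and halves: "card {v\<in>S. [2 * v = \<Sum>S] (mod m)} \<le> 1" and i: "i \<in> S"
  shows "light m S i"
  unfolding light_def
proof (intro ballI impI)
  fix x assume x: "x \<in> indecomposables m" "{i. x i \<noteq> 0} = S"
  have "finite S" using card by (metis card.infinite not_numeral_le_zero)
  moreover have "x i \<noteq> 0" using x(2) i by blast
  ultimately have "sum x (S - {i}) < sum x S" using i by (intro sum_remove_lt)
  then show "sum x (S - {i}) + card S + 1 \<le> m"
    using indecomposable_length_ge3[OF m x(1) card x(2)[symmetric]] halves by simp
qed

text \<open>Erasing coordinate \<open>i\<close> entirely leaves a zero-sum free sequence on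
  \<open>S - {i}\<close>, which still has at least three elements. The length bound suffices as soon
  as no element of \<open>S - {i}\<close> is half of its sum, so such an \<open>i\<close> is
  sought.\<close>

lemma light_coordinate_ge4:
  assumes m: "m \<ge> 4" and S: "S \<subseteq> {1..m-1}" and card: "card S \<ge> 4"
    and a: "a \<in> S" "[2 * a = \<Sum>S] (mod m)" "b \<in> S" "[2 * b = \<Sum>S] (mod m)" "a \<noteq> b"
  shows "\<exists>i\<in>S. light m S i"
proof -
  have fin: "finite S" using S finite_subset by blast
  \<comment> \<open>If every \<open>i\<close> had such a \<open>v = f i\<close>, then \<open>f\<close> would permute \<open>S\<close> and doubling would be injective on \<open>S\<close>.\<close>
  have "\<exists>i\<in>S. \<forall>v\<in>S - {i}. \<not> [2 * v = \<Sum>(S - {i})] (mod m)"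
  proof (rule ccontr)
    assume "\<not> ?thesis"
    then have "\<forall>i\<in>S. \<exists>v\<in>S. [2 * v = \<Sum>(S - {i})] (mod m)" by blast
    then obtain f where f: "\<And>i. i \<in> S \<Longrightarrow> f i \<in> S" "\<And>i. i \<in> S \<Longrightarrow> [2 * f i = \<Sum>(S - {i})] (mod m)"
      by metis
    have eq: "i = j" if "i \<in> S" "j \<in> S" "[2 * f i = 2 * f j] (mod m)" for i j
    proof (rule sum_remove_cong_imp_eq[OF fin S that(1,2)])
      show "[\<Sum>(S - {i}) = \<Sum>(S - {j})] (mod m)"
        using f(2)[OF that(1)] f(2)[OF that(2)] that(3) by (meson cong_sym cong_trans)
    qed
    have "inj_on f S" using eq by (intro inj_onI) simp
    then have "f ` S = S" using f(1) fin by (intro endo_inj_surj) auto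
    then obtain i j where ij: "i \<in> S" "a = f i" "j \<in> S" "b = f j" using a(1,3) by (metis imageE)
    have "[2 * f i = 2 * f j] (mod m)" using a(2,4) ij(2,4) by (metis cong_sym cong_trans)
    then show False using eq[OF ij(1,3)] ij(2,4) a(5) by blast
  qed
  then obtain i where i: "i \<in> S" "\<forall>v\<in>S - {i}. \<not> [2 * v = \<Sum>(S - {i})] (mod m)" by blast
  have "light m S i" unfolding light_def
  proof (intro ballI impI)
    fix x assume x: "x \<in> indecomposables m" "{i. x i \<noteq> 0} = S"
    let ?z = "x(i := 0)"
    have "x i \<noteq> 0" using i(1) x(2) by blast
    then have "?z \<noteq> x" by (metis fun_upd_same)
    then have zf: "zero_free m ?z"
      by (intro indecomposable_zero_free[OF x(1)]) (auto simp: le_fun_def)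
    have supp: "{j. ?z j \<noteq> 0} = S - {i}" using x(2) by auto
    have "sum ?z {1..m-1} = sum ?z (S - {i})" using supp S by (intro sum_supp) auto
    also have "\<dots> = sum x (S - {i})" by (intro sum.cong) auto
    finally have sum: "sum ?z {1..m-1} = sum x (S - {i})" .
    have cd: "card (S - {i}) = card S - 1" using i(1) by simp
    have "{v\<in>S - {i}. [2 * v = \<Sum>(S - {i})] (mod m)} = {}" using i(2) by blast
    then have "card {v\<in>S - {i}. [2 * v = \<Sum>(S - {i})] (mod m)} = 0" by (simp only: card.empty)
    then have "sum x (S - {i}) + (card S - 1) + 2 \<le> m"
      using zero_free_length_ge3[OF _ zf supp[symmetric]] sum cd card m by simp
    then show "sum x (S - {i}) + card S + 1 \<le> m" using card by simp
  qed
  with i(1) show ?thesis by blast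
qed

text \<open>The bounds leave no slack: \<open>x a = 1\<close>, and \<open>x c = 1\<close> because
  two copies of \<open>c\<close> would be a solution, so \<open>x b = m - 4\<close>. Substituting
  \<open>a = b + c\<close> and \<open>2 c = 0\<close> modulo \<open>m\<close> into the equation for
  \<open>x\<close> leaves \<open>3 b = 0\<close>.\<close>

lemma bad_coordinate_card3:
  assumes x: "x \<in> indecomposables m" and supp: "{i. x i \<noteq> 0} = {a, b, c}"
    and distinct: "a \<noteq> b" "a \<noteq> c" "b \<noteq> c"
    and d: "int m dvd int a - int b - int c" "int m dvd 2 * int c"
    and len: "x a + x b + x c + 2 \<le> m" and bad: "x b + x c + 4 > m"
  shows "int m dvd 3 * int b"
proof -
  have pos: "x a \<noteq> 0" "x b \<noteq> 0" "x c \<noteq> 0" using supp by blast+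
  have sub: "{a, b, c} \<subseteq> {1..m-1}" using indecomposable_supp[OF x] supp by simp
  have "\<not> x c \<ge> 2"
  proof
    assume "x c \<ge> 2"
    moreover have "m dvd 2 * c" using d(2) by (metis of_nat_dvd_iff of_nat_mult of_nat_numeral)
    ultimately have "{i. x i \<noteq> 0} = {c}" using indecomposable_axis[OF x, of 2 c] by simp
    then show False using supp distinct by auto
  qed
  then have vals: "x a = 1" "x c = 1" "x b + 4 = m" using pos len bad by linarith+
  have "wsum m x = (\<Sum>i\<in>{a, b, c}. i * x i)" using supp sub by (intro wsum_supp) auto
  also have "\<dots> = a + b * x b + c" using distinct vals by simp
  finally have "m dvd a + b * x b + c"
    using indecomposable_solution[OF x] by (simp add: solutions_iff)
  then have "int m dvd int (a + b * x b + c)" by (simp only: of_nat_dvd_iff)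
  then have e: "int m dvd int a + int b * int (x b) + int c" by simp
  have xb: "int (x b) = int m - 4" using vals(3) by linarith
  have "3 * int b = int m * int b + (int a - int b - int c) + 2 * int c
      - (int a + int b * int (x b) + int c)"
    unfolding xb by (simp add: algebra_simps)
  then show ?thesis using d e by (metis dvd_add dvd_diff dvd_triv_left)
qed

text \<open>Modulo \<open>m\<close>, the two halving conditions say \<open>a = b + c\<close> and
  \<open>b = a + c\<close>, whence \<open>2 c = 0\<close>. If neither coordinate were light, then
  \<open>3 a = 3 b = 0\<close>, so \<open>c = 3 c = 3 (a - b) = 0\<close>, which is
  impossible.\<close>

lemma light_coordinate_3:
  assumes m: "m \<ge> 4" and S: "S \<subseteq> {1..m-1}" and card: "card S = 3"
    and a: "a \<in> S" "[2 * a = \<Sum>S] (mod m)" "b \<in> S" "[2 * b = \<Sum>S] (mod m)" "a \<noteq> b"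
  shows "light m S a \<or> light m S b"
proof (rule ccontr)
  assume bad: "\<not> ?thesis"
  have fin: "finite S" using S finite_subset by blast
  have "card (S - {a, b}) = 1" using card a by (simp add: card_Diff_subset)
  then obtain c where "S - {a, b} = {c}" by (auto simp: card_1_singleton_iff)
  then have Sc: "S = {a, b, c}" and ne: "c \<noteq> a" "c \<noteq> b" using a by blast+
  have sum: "\<Sum>S = a + b + c" using Sc ne a(5) by simp
  have "int m dvd 2 * int a - (int a + int b + int c)"
    using a(2) unfolding sum cong_int_iff[symmetric] cong_iff_dvd_diff by simp
  then have da: "int m dvd int a - int b - int c" by (simp add: algebra_simps)
  have "int m dvd 2 * int b - (int a + int b + int c)"
    using a(4) unfolding sum cong_int_iff[symmetric] cong_iff_dvd_diff by simp
  then have db: "int m dvd int b - int a - int c" by (simp add: algebra_simps)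
  have "2 * int c = - ((int a - int b - int c) + (int b - int a - int c))" by simp
  then have dc: "int m dvd 2 * int c" using da db by (metis dvd_add dvd_minus_iff)
  have cS: "c \<in> {1..m-1}" using S Sc by blast
  \<comment> \<open>The third element \<open>c\<close> is not a half of \<open>\<Sum>S\<close>,
    since \<open>2 c = 0\<close> would make \<open>\<Sum>S\<close> zero modulo \<open>m\<close>.
    Hence there are at most two halves.\<close>
  have len: "sum x S + 2 \<le> m" if x: "x \<in> indecomposables m" "{i. x i \<noteq> 0} = S" for x
  proof (cases "\<exists>j. x j \<ge> 2")
    case False
    then show ?thesis using sum_all_one[OF False] two_card_supp_le[OF m x(1)] card x(2) by simp
  next
    case True
    then obtain j where j: "x j \<ge> 2" by blast
    note z = indecomposable_pred[OF x(1) j, unfolded x(2)]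
    have "\<not> m dvd \<Sum>S" using zero_free_subset_sum[OF z(1), unfolded z(2), of S] a(1) by blast
    moreover have "m dvd \<Sum>S" if "[2 * c = \<Sum>S] (mod m)"
    proof -
      have "m dvd 2 * c" using dc by (metis of_nat_dvd_iff of_nat_mult of_nat_numeral)
      then show ?thesis using that by (metis cong_dvd_iff)
    qed
    ultimately have "{v\<in>S. [2 * v = \<Sum>S] (mod m)} \<subseteq> {a, b}" using Sc by blast
    then have "card {v\<in>S. [2 * v = \<Sum>S] (mod m)} \<le> card {a, b}" by (intro card_mono) auto
    then have "card {v\<in>S. [2 * v = \<Sum>S] (mod m)} \<le> 2" using a(5) by simp
    then show ?thesis using indecomposable_length_ge3[OF m x(1) _ x(2)[symmetric]] card by simp
  qed
  have "\<not> light m S a" "\<not> light m S b" using bad by blast+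
  obtain x where x: "x \<in> indecomposables m" "{i. x i \<noteq> 0} = S" "\<not> sum x (S - {a}) + card S + 1 \<le> m"
    using \<open>\<not> light m S a\<close> unfolding light_def by blast
  obtain y where y: "y \<in> indecomposables m" "{i. y i \<noteq> 0} = S" "\<not> sum y (S - {b}) + card S + 1 \<le> m"
    using \<open>\<not> light m S b\<close> unfolding light_def by blast
  have Sa: "S - {a} = {b, c}" and Sb: "S - {b} = {a, c}" using Sc ne a(5) by blast+
  have b3: "int m dvd 3 * int b"
  proof (rule bad_coordinate_card3[OF x(1) _ _ _ _ da dc])
    show "{i. x i \<noteq> 0} = {a, b, c}" using x(2) Sc by simp
    show "x a + x b + x c + 2 \<le> m" using len[OF x(1,2)] Sc ne a(5) by simp
    show "m < x b + x c + 4" using x(3) ne unfolding Sa card by simp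
  qed (use ne a(5) in auto)
  have a3: "int m dvd 3 * int a"
  proof (rule bad_coordinate_card3[OF y(1) _ _ _ _ db dc])
    show "{i. y i \<noteq> 0} = {b, a, c}" using y(2) Sc by auto
    show "y b + y a + y c + 2 \<le> m" using len[OF y(1,2)] Sc ne a(5) by simp
    show "m < y a + y c + 4" using y(3) ne unfolding Sb card by simp
  qed (use ne a(5) in auto)
  have "int c = 3 * int a - 3 * int b - 3 * (int a - int b - int c) - 2 * int c" by simp
  then have "int m dvd int c" using a3 b3 da dc by (metis dvd_diff dvd_mult)
  then have "m dvd c" by simp
  then show False using cS by (auto dest: dvd_imp_le)
qed

lemma indecomposable_length_2:
  assumes m: "m \<ge> 4" and x: "x \<in> indecomposables m" and supp: "{i. x i \<noteq> 0} = {a, b}" and ne: "a \<noteq> b"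
  shows "x a + x b + 1 \<le> m"
proof (cases "\<exists>j. x j \<ge> 2")
  case True
  then obtain j where j: "x j \<ge> 2" by blast
  note z = indecomposable_pred[OF x j, unfolded supp]
  show ?thesis using zero_free_length_ge2[OF _ z(1)] m z(2,3) ne by simp
next
  case False
  then show ?thesis using sum_all_one[OF False] m supp ne by simp
qed

text \<open>The total length is at most \<open>m - 1\<close>, which forces \<open>x a = 1\<close>
  and \<open>x b = m - 2\<close>; the equation for \<open>x\<close> then reads
  \<open>a = 2 b\<close> modulo \<open>m\<close>.\<close>

lemma bad_coordinate_card2:
  assumes m: "m \<ge> 4" and x: "x \<in> indecomposables m" and supp: "{i. x i \<noteq> 0} = {a, b}" and ne: "a \<noteq> b"
    and bad: "x b + 3 > m"
  shows "int m dvd int a - 2 * int b" "x b + 2 = m"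
proof -
  have sub: "{a, b} \<subseteq> {1..m-1}" using indecomposable_supp[OF x] supp by simp
  have "x a \<noteq> 0" using supp by blast
  then have vals: "x a = 1" "x b + 2 = m" using indecomposable_length_2[OF m x supp ne] bad by linarith+
  have "wsum m x = (\<Sum>i\<in>{a, b}. i * x i)" using supp sub by (intro wsum_supp) auto
  also have "\<dots> = a + b * x b" using ne vals by simp
  finally have "m dvd a + b * x b"
    using indecomposable_solution[OF x] by (simp add: solutions_iff)
  then have "int m dvd int (a + b * x b)" by (simp only: of_nat_dvd_iff)
  then have e: "int m dvd int a + int b * int (x b)" by simp
  have xb: "int (x b) = int m - 2" using vals(2) by linarith
  have "int a - 2 * int b = (int a + int b * int (x b)) - int m * int b"
    unfolding xb by (simp add: algebra_simps)
  then show "int m dvd int a - 2 * int b" using e by (metis dvd_diff dvd_triv_left)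
  show "x b + 2 = m" by (rule vals)
qed

text \<open>If both coordinates fail, \<open>a = 2 b\<close> and \<open>b = 2 a\<close> modulo
  \<open>m\<close>, so \<open>3 b = 0\<close>, and three copies of \<open>b\<close> would already be
  a solution.\<close>

lemma light_coordinate_2:
  assumes m: "m \<ge> 4" and S: "S \<subseteq> {1..m-1}" and card: "card S = 2"
  shows "\<exists>i\<in>S. light m S i"
proof (rule ccontr)
  assume bad: "\<not> ?thesis"
  obtain a b where ab: "S = {a, b}" "a \<noteq> b" using card by (auto simp: card_2_iff)
  have Sa: "S - {a} = {b}" and Sb: "S - {b} = {a}" using ab by blast+
  have "\<not> light m S a" "\<not> light m S b" using bad ab by blast+
  obtain x where x: "x \<in> indecomposables m" "{i. x i \<noteq> 0} = S" "\<not> sum x (S - {a}) + card S + 1 \<le> m"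
    using \<open>\<not> light m S a\<close> unfolding light_def by blast
  obtain y where y: "y \<in> indecomposables m" "{i. y i \<noteq> 0} = S" "\<not> sum y (S - {b}) + card S + 1 \<le> m"
    using \<open>\<not> light m S b\<close> unfolding light_def by blast
  have ba: "{b, a} = S" using ab by blast
  have xb: "x b + 3 > m" using x(3) unfolding Sa card by simp
  have ya: "y a + 3 > m" using y(3) unfolding Sb card by simp
  note dx = bad_coordinate_card2[OF m x(1) x(2)[unfolded ab(1)] ab(2) xb]
  note dy = bad_coordinate_card2[OF m y(1) y(2)[folded ba] ab(2)[symmetric] ya]
  have "3 * int b = - ((int b - 2 * int a) + 2 * (int a - 2 * int b))" by simp
  then have "int m dvd 3 * int b" using dx(1) dy(1) by (metis dvd_add dvd_minus_iff dvd_mult)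
  then have b3: "m dvd 3 * b" by (metis of_nat_dvd_iff of_nat_mult of_nat_numeral)
  show False
  \<comment> \<open>For \<open>m = 4\<close> there are only \<open>m - 2 = 2\<close> copies of
    \<open>b\<close>, but then 3 is invertible and \<open>b\<close> itself would vanish modulo
    4.\<close>
  proof (cases "m = 4")
    case True
    then have "4 dvd 3 * b" using b3 by simp
    then have "4 dvd b" by presburger
    then show False using S ab(1) True by (auto dest: dvd_imp_le)
  next
    case False
    then have "x b \<ge> 3" using m dx(2) by linarith
    then have "{i. x i \<noteq> 0} = {b}" using b3 indecomposable_axis[OF x(1), of 3 b] by simp
    then show False using x(2) ab by auto
  qed
qed

lemma light_coordinate:
  assumes m: "m \<ge> 4" and S: "S \<subseteq> {1..m-1}" "S \<noteq> {}" and two: "2 * card S \<le> m"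
  shows "\<exists>i\<in>S. light m S i"
proof -
  have fin: "finite S" using S finite_subset by blast
  then have "card S \<noteq> 0" using S by simp
  then consider "card S = 1" | "card S = 2" | "card S \<ge> 3" by linarith
  then show ?thesis
  proof cases
    case 1
    then obtain i where i: "S = {i}" by (auto simp: card_1_singleton_iff)
    then have "light m S i" using m by (simp add: light_def)
    then show ?thesis using i by blast
  next
    case 2
    then show ?thesis using light_coordinate_2[OF m S(1)] by blast
  next
    case 3
    let ?E = "{v\<in>S. [2 * v = \<Sum>S] (mod m)}"
    show ?thesis
    proof (cases "card ?E \<le> 1")
      case True
      then show ?thesis using light_coordinate_few_halves[OF m 3] S(2) by blast
    next
      case False
      have "finite ?E" using fin by simp
      from False have "\<not> (\<forall>a\<in>?E. \<forall>b\<in>?E. a = b)"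
        unfolding One_nat_def card_le_Suc0_iff_eq[OF \<open>finite ?E\<close>] .
      then obtain a b where ab: "a \<in> S" "[2 * a = \<Sum>S] (mod m)" "b \<in> S" "[2 * b = \<Sum>S] (mod m)" "a \<noteq> b"
        by blast
      show ?thesis
      proof (cases "card S = 3")
        case True
        then show ?thesis using light_coordinate_3[OF m S(1) True ab] ab(1,3) by blast
      next
        case False
        then have "card S \<ge> 4" using 3 by simp
        then show ?thesis using light_coordinate_ge4[OF m S(1) _ ab] by blast
      qed
    qed
  qed
qed

section \<open>Counting by supports\<close>

text \<open>Stars and bars: the value \<open>Suc k\<close> at a new coordinate leaves
  \<open>N - Suc k\<close> for the others, and the resulting binomials add up by the hockey-stick
  identity. Finiteness is carried along because \<open>card\<close> of an infinite set is 0.\<close>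

lemma card_compositions_le:
  fixes N :: nat
  assumes "finite (A :: nat set)"
  shows "finite {f :: nat \<Rightarrow> nat. {i. f i \<noteq> 0} = A \<and> sum f A \<le> N} \<and>
    card {f :: nat \<Rightarrow> nat. {i. f i \<noteq> 0} = A \<and> sum f A \<le> N} \<le> N choose card A"
  using assms
proof (induction A arbitrary: N rule: finite_induct)
  case empty
  have "{f :: nat \<Rightarrow> nat. {i. f i \<noteq> 0} = {} \<and> sum f {} \<le> N} = {\<lambda>_. 0}" by auto
  then show ?case by simp
next
  case (insert a A)
  define F where "F A N = {f :: nat \<Rightarrow> nat. {i. f i \<noteq> 0} = A \<and> sum f A \<le> N}" for A N
  let ?ext = "\<lambda>k. (\<lambda>g. g(a := Suc k)) ` F A (N - Suc k)"
  have IH: "finite (F A M)" "card (F A M) \<le> M choose card A" for M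
    using insert.IH[of M] by (simp_all add: F_def)
  have sub: "F (insert a A) N \<subseteq> (\<Union>k<N. ?ext k)"
  proof
    fix f assume "f \<in> F (insert a A) N"
    then have supp: "{i. f i \<noteq> 0} = insert a A" and le: "sum f (insert a A) \<le> N"
      by (simp_all add: F_def)
    have "f a \<noteq> 0" using supp by blast
    then obtain k where k: "f a = Suc k" using not0_implies_Suc by blast
    have sum: "Suc k + sum f A \<le> N" using le k insert.hyps by simp
    have "{i. (f(a := 0)) i \<noteq> 0} = {i. f i \<noteq> 0} - {a}" by auto
    also have "\<dots> = A" using supp insert.hyps by blast
    finally have "{i. (f(a := 0)) i \<noteq> 0} = A" .
    moreover have "sum (f(a := 0)) A = sum f A" using insert.hyps by (intro sum.cong) auto
    ultimately have "f(a := 0) \<in> F A (N - Suc k)" using sum by (simp add: F_def)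
    moreover have "f = (f(a := 0))(a := Suc k)" using k by auto
    ultimately have "f \<in> ?ext k" by blast
    then show "f \<in> (\<Union>k<N. ?ext k)" using sum by auto
  qed
  have fin: "finite (\<Union>k<N. ?ext k)" using IH(1) by blast
  have "card (F (insert a A) N) \<le> card (\<Union>k<N. ?ext k)" using sub fin by (rule card_mono[rotated])
  also have "\<dots> \<le> (\<Sum>k<N. card (?ext k))" by (intro card_UN_le) simp
  also have "\<dots> \<le> (\<Sum>k<N. (N - Suc k) choose card A)"
    using IH by (intro sum_mono) (metis card_image_le order_trans)
  also have "\<dots> = (\<Sum>k<N. k choose card A)" by (rule sum.nat_diff_reindex)
  also have "\<dots> = N choose Suc (card A)"
  proof (cases N)
    case (Suc n)
    then show ?thesis using sum_choose_upper[of "card A" n] by (simp only: lessThan_Suc_atMost)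
  qed simp
  finally have "card (F (insert a A) N) \<le> N choose card (insert a A)" using insert.hyps by simp
  then show ?case using finite_subset[OF sub fin] unfolding F_def by simp
qed

lemma indecomposable_antichain:
  assumes "x \<in> indecomposables m" "y \<in> indecomposables m" "x \<le> y"
  shows "x = y"
  using assms unfolding indecomposables_def by blast

lemma indecomposable_eq_off:
  assumes x: "x \<in> indecomposables m" and y: "y \<in> indecomposables m" and off: "x(i := 0) = y(i := 0)"
  shows "x = y"
proof -
  have eq: "x j = y j" if "j \<noteq> i" for j using fun_cong[OF off, of j] that by simp
  show ?thesis
  proof (cases "x i \<le> y i")
    case True
    then have "x j \<le> y j" for j using eq[of j] by (cases "j = i") simp_all
    then show ?thesis using indecomposable_antichain[OF x y] by (simp add: le_funI)
  next
    case False
    then have "y j \<le> x j" for j using eq[of j] by (cases "j = i") simp_all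
    then show ?thesis using indecomposable_antichain[OF y x] by (simp add: le_funI)
  qed
qed

text \<open>Erasing a light coordinate is injective by \<open>indecomposable_eq_off\<close> and
  lands among the vectors counted in \<open>card_compositions_le\<close>. The empty case is separate
  because \<open>2 * card S \<le> m\<close> is derived from an actual solution.\<close>

lemma card_indecomposables_supp_le:
  assumes m: "m \<ge> 4" and S: "S \<subseteq> {1..m-1}"
  shows "card {x \<in> indecomposables m. {i. x i \<noteq> 0} = S} \<le> (m - 1 - card S) choose (card S - 1)"
proof (cases "{x \<in> indecomposables m. {i. x i \<noteq> 0} = S} = {}")
  case True
  then show ?thesis by (simp only: card.empty)
next
  case False
  let ?I = "{x \<in> indecomposables m. {i. x i \<noteq> 0} = S}"
  obtain x where x: "x \<in> indecomposables m" "{i. x i \<noteq> 0} = S" using False by blast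
  have "S \<noteq> {}" "2 * card S \<le> m"
    using indecomposable_supp_nonempty[OF x(1)] two_card_supp_le[OF m x(1)] unfolding x(2) by blast+
  then obtain i where i: "i \<in> S" "light m S i" using light_coordinate[OF m S] by blast
  have fin: "finite (S - {i})" using S finite_subset by blast
  let ?F = "{f :: nat \<Rightarrow> nat. {j. f j \<noteq> 0} = S - {i} \<and> sum f (S - {i}) \<le> m - 1 - card S}"
  have "card ?I \<le> card ?F"
  proof (rule card_inj_on_le)
    show "inj_on (\<lambda>x. x(i := 0)) ?I"
      by (intro inj_onI) (metis (mono_tags, lifting) indecomposable_eq_off mem_Collect_eq)
    show "finite ?F" using card_compositions_le[OF fin] by blast
    show "(\<lambda>x. x(i := 0)) ` ?I \<subseteq> ?F"
    proof (rule image_subsetI)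
      fix x assume "x \<in> ?I"
      then have x: "x \<in> indecomposables m" "{i. x i \<noteq> 0} = S" by simp_all
      have "{j. (x(i := 0)) j \<noteq> 0} = {j. x j \<noteq> 0} - {i}" by auto
      moreover have "sum (x(i := 0)) (S - {i}) = sum x (S - {i})" by (intro sum.cong) auto
      moreover have "sum x (S - {i}) + card S + 1 \<le> m" using i(2) x unfolding light_def by blast
      ultimately show "x(i := 0) \<in> ?F" using x(2) by simp
    qed
  qed
  also have "\<dots> \<le> (m - 1 - card S) choose card (S - {i})" using card_compositions_le[OF fin] by blast
  finally show ?thesis using i(1) by simp
qed

lemma SD_ge: "m \<ge> 2 \<Longrightarrow> x \<in> indecomposables m \<Longrightarrow> card {i. x i \<noteq> 0} \<le> SD m"
  unfolding SD_def width_def by (intro Max_ge finite_imageI finite_indecomposables) auto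

lemma two_SD_le:
  assumes m: "m \<ge> 4"
  shows "2 * SD m \<le> m"
proof -
  have "SD m \<in> width ` indecomposables m" unfolding SD_def
    using m finite_indecomposables[of m] indecomposables_nonempty[of m] by (intro Max_in) simp_all
  then show ?thesis using two_card_supp_le[OF m] by (auto simp: width_def)
qed

lemma ell_le_sum_binomials:
  assumes m: "m \<ge> 4"
  shows "ell m \<le> (\<Sum>s=1..SD m. ((m - 1) choose s) * ((m - 1 - s) choose (s - 1)))"
proof -
  let ?S = "\<lambda>s. {S. S \<subseteq> {1..m-1} \<and> card S = s}"
  let ?I = "\<lambda>S. {x \<in> indecomposables m. {i. x i \<noteq> 0} = S}"
  have finS: "finite (?S s)" for s by (rule finite_subset[of _ "Pow {1..m-1}"]) auto
  have fin: "finite (indecomposables m)" using m by (intro finite_indecomposables) simp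
  have "x \<in> (\<Union>s\<in>{1..SD m}. \<Union>S\<in>?S s. ?I S)" if x: "x \<in> indecomposables m" for x
  proof -
    let ?T = "{i. x i \<noteq> 0}"
    have T: "?T \<subseteq> {1..m-1}" using indecomposable_supp[OF x] .
    then have "finite ?T" using finite_subset by blast
    then have "card ?T \<noteq> 0" using indecomposable_supp_nonempty[OF x] card_0_eq by blast
    then have "card ?T \<in> {1..SD m}" using SD_ge[OF _ x] m by simp
    moreover have "?T \<in> ?S (card ?T)" using T by simp
    moreover have "x \<in> ?I ?T" using x by simp
    ultimately show ?thesis by blast
  qed
  then have "indecomposables m \<subseteq> (\<Union>s\<in>{1..SD m}. \<Union>S\<in>?S s. ?I S)" by blast
  then have "ell m \<le> card (\<Union>s\<in>{1..SD m}. \<Union>S\<in>?S s. ?I S)"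
    unfolding ell_def using fin finS by (intro card_mono finite_UN_I) auto
  also have "\<dots> \<le> (\<Sum>s=1..SD m. card (\<Union>S\<in>?S s. ?I S))" by (intro card_UN_le) simp
  also have "\<dots> \<le> (\<Sum>s=1..SD m. ((m - 1) choose s) * ((m - 1 - s) choose (s - 1)))"
  proof (rule sum_mono)
    fix s
    have "card (\<Union>S\<in>?S s. ?I S) \<le> (\<Sum>S\<in>?S s. card (?I S))" using finS by (rule card_UN_le)
    also have "\<dots> \<le> (\<Sum>S\<in>?S s. (m - 1 - s) choose (s - 1))"
    proof (rule sum_mono)
      fix S assume "S \<in> ?S s"
      then show "card (?I S) \<le> (m - 1 - s) choose (s - 1)"
        using card_indecomposables_supp_le[OF m, of S] by blast
    qed
    also have "\<dots> = ((m - 1) choose s) * ((m - 1 - s) choose (s - 1))"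
      using n_subsets[of "{1..m-1}" s] by simp
    finally show "card (\<Union>S\<in>?S s. ?I S) \<le> ((m - 1) choose s) * ((m - 1 - s) choose (s - 1))" .
  qed
  finally show ?thesis .
qed

section \<open>Trinomial coefficients and the exponential bound\<close>

lemma trinomial_eq_binomials:
  assumes "p + q + r = n"
  shows "trinomial n p q r = (n choose p) * ((n - p) choose q)"
proof -
  have "fact n = fact p * fact (n - p) * (n choose p)"
    using assms by (intro binomial_fact_lemma[symmetric]) simp
  also have "fact (n - p) = fact q * fact r * ((n - p) choose q)"
    using assms binomial_fact_lemma[of q "n - p"] by auto
  finally have "fact n = (fact p * fact q * fact r) * ((n choose p) * ((n - p) choose q))"
    by (simp only: mult_ac)
  then show ?thesis unfolding trinomial_def by (simp only: nonzero_mult_div_cancel_left) simp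
qed

text \<open>At most the coordinates 1 and 2 occur, so \<open>x 2\<close> determines \<open>x\<close>
  by \<open>indecomposable_eq_off\<close>. It takes one value for \<open>m = 2\<close> and at most
  four for \<open>m = 3\<close>.\<close>

lemma ell_lt_small:
  assumes "m = 2 \<or> m = 3"
  shows "ell m < 3 ^ (m - 1)"
proof -
  have m: "m \<ge> 2" using assms by auto
  have "ell m \<le> card {..if m = 2 then 0 else 3::nat}" unfolding ell_def
  proof (rule card_inj_on_le)
    show "inj_on (\<lambda>x. x 2) (indecomposables m)"
    proof (rule inj_onI)
      fix x y assume xy: "x \<in> indecomposables m" "y \<in> indecomposables m" "x 2 = y 2"
      have "x j = y j" if "j \<noteq> 1" for j
      proof (cases "j = 2")
        case False
        then have "j \<notin> {1..m-1}" using assms that by auto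
        then have "x j = 0" "y j = 0"
          using xy(1,2)[THEN indecomposable_solution] unfolding solutions_def by blast+
        then show ?thesis by simp
      qed (use xy(3) in simp)
      then have "x(1 := 0) = y(1 := 0)" by auto
      then show "x = y" using indecomposable_eq_off[OF xy(1,2)] by blast
    qed
    show "(\<lambda>x. x 2) ` indecomposables m \<subseteq> {..if m = 2 then 0 else 3}"
    proof (rule image_subsetI)
      fix x assume x: "x \<in> indecomposables m"
      have "x 2 \<le> m" using x by (rule indecomposable_le[OF m])
      moreover have "x 2 = 0" if "m = 2"
        using indecomposable_solution[OF x] that by (simp add: solutions_def)
      ultimately show "x 2 \<in> {..if m = 2 then 0 else 3}" using assms by auto
    qed
  qed simp
  then show ?thesis using assms by auto
qed

text \<open>Bounding the second factor by \<open>2 ^ (n - s)\<close> gives part of the expansion of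
  \<open>(1 + 2) ^ n\<close>; strictness comes from the missing term \<open>2 ^ n\<close> at
  \<open>s = 0\<close>.\<close>

lemma sum_binomials_lt:
  assumes "k \<le> n"
  shows "(\<Sum>s=1..k. (n choose s) * ((n - s) choose (s - 1))) < 3 ^ n"
proof -
  have "(\<Sum>s=1..k. (n choose s) * ((n - s) choose (s - 1))) \<le> (\<Sum>s=1..k. (n choose s) * 2 ^ (n - s))"
    by (intro sum_mono mult_left_mono binomial_le_pow2) simp
  also have "\<dots> \<le> (\<Sum>s=1..n. (n choose s) * 2 ^ (n - s))"
    using assms by (intro sum_mono2) auto
  also have "\<dots> < (\<Sum>s=1..n. (n choose s) * 2 ^ (n - s)) + 2 ^ n" by simp
  also have "\<dots> = (\<Sum>s\<le>n. (n choose s) * 2 ^ (n - s))"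
    by (simp add: atMost_atLeast0 sum.atLeast_Suc_atMost)
  also have "\<dots> = 3 ^ n" using binomial[of 1 2 n] by (simp add: numeral_3_eq_3)
  finally show ?thesis .
qed

theorem theorem2:
  shows "(\<forall>m\<ge>4. ell m \<le> (\<Sum>s=1..SD m. trinomial (m-1) s (s-1) (m-2*s)))
       \<and> (\<forall>m\<ge>2. ell m < 3^(m-1))"
proof (intro conjI allI impI)
  fix m :: nat assume m: "m \<ge> 4"
  have "trinomial (m-1) s (s-1) (m-2*s) = ((m - 1) choose s) * ((m - 1 - s) choose (s - 1))"
    if "s \<in> {1..SD m}" for s
    using that two_SD_le[OF m] by (intro trinomial_eq_binomials) auto
  then show "ell m \<le> (\<Sum>s=1..SD m. trinomial (m-1) s (s-1) (m-2*s))"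
    using ell_le_sum_binomials[OF m] by simp
next
  fix m :: nat assume m: "m \<ge> 2"
  show "ell m < 3 ^ (m - 1)"
  proof (cases "m \<ge> 4")
    case True
    then have "SD m \<le> m - 1" using two_SD_le[OF True] by simp
    then show ?thesis using ell_le_sum_binomials[OF True] sum_binomials_lt[of "SD m" "m - 1"] by linarith
  next
    case False
    then show ?thesis using m by (intro ell_lt_small) auto
  qed
qed

end
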